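(* Let $\Delta$ be a non-pure shellable simplicial complex of dimension less than $n$, with $h$-triangle entries $h_{k,i}$. Then the $\mathbf{cd}$-index of the semisuspension of $\Delta$ is given by $$\Psi(\mathrm{Semi}(\Delta,n))=\sum_{k=0}^{n}\sum_{i=0}^{k}h_{k,i}\cdot\check\Phi(n,k,i).$$
   Context: A quasi-graded poset $(P,\rho,\bar\zeta)$ consists of a finite poset $P$, a function $\rho:P\to\mathbb N$ with $x<y\Rightarrow\rho(x)<\rho(y)$, and a function $\bar\zeta$ in the incidence algebra of $P$ with $\bar\zeta(x,x)=1$. Write $\rho(x,y)=\rho(y)-\rho(x)$. If $P$ has minimal element $\hat0$ and maximal element $\hat1$, $\hat0<\hat1$, its $\mathbf{ab}$-index is the polynomial in non-commuting variables $\mathbf a,\mathbf b$ $$\Psi(P)=\sum\bar\zeta(x_0,x_1)\cdots\bar\zeta(x_{k-1},x_k)\cdot(\mathbf a-\mathbf b)^{\rho(x_0,x_1)-1}\,\mathbf b\,(\mathbf a-\mathbf b)^{\rho(x_1,x_2)-1}\,\mathbf b\cdots\mathbf b\,(\mathbf a-\mathbf b)^{\rho(x_{k-1},x_k)-1},$$ summed over all chains $\hat0=x_0<x_1<\cdots<x_k=\hat1$. For the posets here it is a polynomial in $\mathbf c=\mathbf a+\mathbf b$, $\mathbf d=\mathbf a\mathbf b+\mathbf b\mathbf a$ and is then called the $\mathbf{cd}$-index. Semisuspension. For $n\ge1$ and a finite simplicial complex $\Delta$ (containing $\emptyset$) with $\dim\Delta<n$, $\mathrm{Semi}(\Delta,n)$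 is obtained by embedding $\Delta$ in the boundary of an $n$-ball, and $\Psi(\mathrm{Semi}(\Delta,n))$ is the $\mathbf{ab}$-index of its face poset $\mathcal F(\mathrm{Semi}(\Delta,n))$, which is the following quasi-graded poset, independent of the embedding: the elements are the faces of $\Delta$ (with $\hat0=\emptyset$) and two further elements $*$ and $\hat1$; $\rho(F)=\dim F+1$, $\rho( * )=n$, $\rho(\hat1)=n+1$; faces are ordered by inclusion, every other element is $<\hat1$, and $F<*$ for every face $F$ with $\rho(F)<n$ (faces of dimension $n-1$ are incomparable to $*$); $$\bar\zeta(F,* )=1+(-1)^{n-\rho(F)}\,\widetilde\chi(\mathrm{link}_\Delta(F)),\qquad\widetilde\chi(\mathrm{link}_\Delta(F))=\sum_{H\in\Delta,\,H\supseteq F}(-1)^{\dim H-\dim F-1},$$ and $\bar\zeta=1$ on all other intervals. Shelling components. For $0\le i\le k$, $\Delta_{k,i}$ is the simplicial complex generated by $i+1$ of the facets of the $k$-dimensional simplex (so $\dim\Delta_{k,i}=k-1$, and $\Delta_{0,0}=\{\emptyset\}$). For $0\le i\le k\le n$ let $P_{n,k,i}=\mathcal F(\mathrm{Semi}(\Delta_{k,i},n))$, and define $\check\Phi(n,k,0)=\Psi(P_{n,k,0})$ and $\check\Phi(n,k,i)=\Psi(P_{n,k,i})-\Psi(P_{n,k,i-1})$ for $1\le i\le k\le n$. Shellability (Björner--Wachs). A finite simplicial complex $\Delta$, whose facets (maximal faces) need not have the same dimension, is non-pure shellable if $\dim\Delta=0$ (any ordering of the facets is a shelling order), or $\dim\Delta\ge1$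 and the facets can be ordered $F_1,\ldots,F_m$ (a shelling order) so that for $r=2,\ldots,m$ the complex $\big(\bigcup_{j=1}^{r-1}\overline{F_j}\big)\cap\overline{F_r}$ is pure of dimension $\dim(F_r)-1$, where $\overline F$ is the complex of all faces of $F$. The facet $F_r$ has shelling type $(k,i)$ if $\dim(F_r)+1=k$ and $\big(\bigcup_{j=1}^{r-1}\overline{F_j}\big)\cap\overline{F_r}$ has $i$ facets (of dimension $k-2$); the first facet $F_1$ has type $(\dim(F_1)+1,0)$. $h_{k,i}$ is the number of facets of shelling type $(k,i)$ in a shelling order; it is known not to depend on the shelling order. *)

theory Defs
  imports Main "HOL-Library.Poly_Mapping"
begin

section \<open>Polynomials in the non-commuting variables a and b\<close>

datatype letter = LA | LB

datatype word = Word "letter list"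

text \<open>
  The free monoid on the two letters, written additively so that
  \<^typ>\<open>word \<Rightarrow>\<^sub>0 int\<close> carries the convolution product of
  \<^theory>\<open>HOL-Library.Poly_Mapping\<close>: it is the free associative ring
  on two generators. A wrapper around lists avoids instantiating
  \<^class>\<open>monoid_add\<close> for the type of lists itself.
\<close>

instantiation word :: monoid_add
begin

definition zero_word :: word where
  "0 = Word []"

fun plus_word :: "word \<Rightarrow> word \<Rightarrow> word" where
  "Word u + Word v = Word (u @ v)"

instance
proof
  fix u v w :: word
  show "u + v + w = u + (v + w)"
    by (cases u; cases v; cases w) simp
  show "0 + u = u"
    by (cases u) (simp add: zero_word_def)
  show "u + 0 = u"
    by (cases u) (simp add: zero_word_def)
qed

end

type_synonym ab_poly = "word \<Rightarrow>\<^sub>0 int"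

definition var_a :: ab_poly where
  "var_a = Poly_Mapping.single (Word [LA]) 1"

definition var_b :: ab_poly where
  "var_b = Poly_Mapping.single (Word [LB]) 1"


section \<open>Quasi-graded posets and the ab-index\<close>

text \<open>
  The order is given by its strict part. The function \<open>qzeta\<close> is an
  element of the incidence algebra: only its values at pairs \<open>x\<close>, \<open>y\<close>
  with \<open>x \<le> y\<close> are meaningful.
\<close>

record 'e qposet =
  elts :: "'e set"
  lt :: "'e \<Rightarrow> 'e \<Rightarrow> bool"
  rk :: "'e \<Rightarrow> nat"
  qzeta :: "'e \<Rightarrow> 'e \<Rightarrow> int"

definition quasi_graded :: "'e qposet \<Rightarrow> bool" where
  "quasi_graded P \<longleftrightarrow>
     finite (elts P) \<and>
     (\<forall>x\<in>elts P. \<not> lt P x x) \<and>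
     (\<forall>x\<in>elts P. \<forall>y\<in>elts P. \<forall>z\<in>elts P. lt P x y \<longrightarrow> lt P y z \<longrightarrow> lt P x z) \<and>
     (\<forall>x\<in>elts P. \<forall>y\<in>elts P. lt P x y \<longrightarrow> rk P x < rk P y) \<and>
     (\<forall>x\<in>elts P. qzeta P x x = 1)"

definition bottom :: "'e qposet \<Rightarrow> 'e" where
  "bottom P = (THE x. x \<in> elts P \<and> (\<forall>y\<in>elts P. y = x \<or> lt P x y))"

definition top_elt :: "'e qposet \<Rightarrow> 'e" where
  "top_elt P = (THE x. x \<in> elts P \<and> (\<forall>y\<in>elts P. y = x \<or> lt P y x))"

definition full_chains :: "'e qposet \<Rightarrow> 'e list set" where
  "full_chains P =
     {xs. xs \<noteq> [] \<and> hd xs = bottom P \<and> last xs = top_elt P \<and>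
          set xs \<subseteq> elts P \<and> sorted_wrt (lt P) xs}"

fun chain_zeta :: "'e qposet \<Rightarrow> 'e list \<Rightarrow> int" where
  "chain_zeta P (x # y # xs) = qzeta P x y * chain_zeta P (y # xs)"
| "chain_zeta P _ = 1"

text \<open>
  The natural number subtraction in the exponents below does not truncate, as
  \<open>rk P x < rk P y\<close> for consecutive elements \<open>x\<close>, \<open>y\<close> of a chain.
\<close>

fun chain_weight :: "'e qposet \<Rightarrow> 'e list \<Rightarrow> ab_poly" where
  "chain_weight P (x # y # z # xs) =
     (var_a - var_b) ^ (rk P y - rk P x - 1) * var_b * chain_weight P (y # z # xs)"
| "chain_weight P [x, y] = (var_a - var_b) ^ (rk P y - rk P x - 1)"
| "chain_weight P _ = 1"

definition ab_index :: "'e qposet \<Rightarrow> ab_poly" where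
  "ab_index P = (\<Sum>xs\<in>full_chains P. of_int (chain_zeta P xs) * chain_weight P xs)"


section \<open>Simplicial complexes\<close>

definition simplicial_complex :: "'a set set \<Rightarrow> bool" where
  "simplicial_complex K \<longleftrightarrow>
     finite K \<and> {} \<in> K \<and> (\<forall>F\<in>K. finite F \<and> (\<forall>G. G \<subseteq> F \<longrightarrow> G \<in> K))"

definition face_dim :: "'a set \<Rightarrow> int" where
  "face_dim F = int (card F) - 1"

definition complex_dim :: "'a set set \<Rightarrow> int" where
  "complex_dim K = Max (face_dim ` K)"

definition facets :: "'a set set \<Rightarrow> 'a set set" where
  "facets K = {F \<in> K. \<forall>G\<in>K. F \<subseteq> G \<longrightarrow> G = F}"

definition pure_of_dim :: "'a set set \<Rightarrow> int \<Rightarrow> bool" where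
  "pure_of_dim K d \<longleftrightarrow> K \<noteq> {} \<and> (\<forall>F\<in>facets K. face_dim F = d)"


section \<open>The semisuspension\<close>

text \<open>
  The sign \<open>(-1) ^ (dim H - dim F - 1)\<close> of the face \<open>H - F\<close> of the link is
  written with the exponent \<open>dim H - dim F + 1\<close> of the same parity, since the
  original exponent is \<open>-1\<close> for \<open>H = F\<close>.
\<close>

definition link_euler :: "'a set set \<Rightarrow> 'a set \<Rightarrow> int" where
  "link_euler K F = (\<Sum>H\<in>{H\<in>K. F \<subseteq> H}. (-1) ^ (card H - card F + 1))"

datatype 'a semi_elt = Face "'a set" | Star | One

fun semi_lt :: "nat \<Rightarrow> 'a semi_elt \<Rightarrow> 'a semi_elt \<Rightarrow> bool" where
  "semi_lt n (Face F) (Face G) \<longleftrightarrow> F \<subset> G"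
| "semi_lt n (Face F) Star \<longleftrightarrow> card F < n"
| "semi_lt n (Face F) One \<longleftrightarrow> True"
| "semi_lt n Star One \<longleftrightarrow> True"
| "semi_lt n Star _ \<longleftrightarrow> False"
| "semi_lt n One _ \<longleftrightarrow> False"

fun semi_rk :: "nat \<Rightarrow> 'a semi_elt \<Rightarrow> nat" where
  "semi_rk n (Face F) = card F"  \<comment> \<open>this is \<open>dim F + 1\<close>\<close>
| "semi_rk n Star = n"
| "semi_rk n One = n + 1"

fun semi_zeta :: "'a set set \<Rightarrow> nat \<Rightarrow> 'a semi_elt \<Rightarrow> 'a semi_elt \<Rightarrow> int" where
  "semi_zeta K n (Face F) Star = 1 + (-1) ^ (n - card F) * link_euler K F"
| "semi_zeta K n _ _ = 1"

definition semi_poset :: "'a set set \<Rightarrow> nat \<Rightarrow> 'a semi_elt qposet" where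
  "semi_poset K n =
     \<lparr>elts = Face ` K \<union> {Star, One}, lt = semi_lt n, rk = semi_rk n, qzeta = semi_zeta K n\<rparr>"

definition Psi_semi :: "'a set set \<Rightarrow> nat \<Rightarrow> ab_poly" where
  "Psi_semi K n = ab_index (semi_poset K n)"

lemma face_card_le:
  assumes "simplicial_complex K" "complex_dim K < int n" "F \<in> K"
  shows "card F \<le> n"
proof -
  have "face_dim F \<le> complex_dim K"
    using assms unfolding complex_dim_def simplicial_complex_def by (intro Max_ge) auto
  then show ?thesis
    using assms(2) by (simp add: face_dim_def)
qed

lemma quasi_graded_semi_poset:
  assumes K: "simplicial_complex K" and dim: "complex_dim K < int n"
  shows "quasi_graded (semi_poset K n)"
proof -
  have fin: "finite K" "\<And>F. F \<in> K \<Longrightarrow> finite F"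
    using K by (auto simp: simplicial_complex_def)
  have mono: "card F < card G" if "F \<subset> G" "G \<in> K" for F G :: "'a set"
    using that fin psubset_card_mono by blast
  define P where "P = semi_poset K n"
  have P: "elts P = Face ` K \<union> {Star, One}" "lt P = semi_lt n" "rk P = semi_rk n"
    "qzeta P = semi_zeta K n"
    by (simp_all add: P_def semi_poset_def)
  have irrefl: "\<not> semi_lt n x x" for x :: "'a semi_elt"
    by (cases x) auto
  have rank: "semi_rk n x < semi_rk n y" if "x \<in> elts P" "y \<in> elts P" "semi_lt n x y" for x y
    using that mono face_card_le[OF K dim]
    by (cases x; cases y) (auto simp: P less_Suc_eq_le)
  have trans: "semi_lt n x z"
    if "x \<in> elts P" "y \<in> elts P" "z \<in> elts P" "semi_lt n x y" "semi_lt n y z" for x y z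
    using that rank[OF that(1,2,4)] rank[OF that(2,3,5)]
    by (cases x; cases y; cases z) auto
  have one: "semi_zeta K n x x = 1" for x
    by (cases x) auto
  have "finite (elts P)"
    using fin(1) by (simp add: P)
  then have "quasi_graded P"
    unfolding quasi_graded_def P(2-4) using irrefl rank trans one by blast
  then show ?thesis
    by (simp add: P_def)
qed

lemma bottom_semi_poset:
  assumes "simplicial_complex K" "0 < n"
  shows "bottom (semi_poset K n) = Face {}"
  unfolding bottom_def semi_poset_def
  using assms by (intro the_equality) (auto simp: simplicial_complex_def)

lemma top_semi_poset: "top_elt (semi_poset K n) = One"
  unfolding top_elt_def semi_poset_def
  by (rule the_equality) auto


section \<open>Shelling components\<close>

text \<open>
  The vertices of the \<open>k\<close>-dimensional simplex are \<open>0, \<dots>, k\<close>; of its facets,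
  the \<open>i + 1\<close> ones opposite to the vertices \<open>0, \<dots>, i\<close> are chosen.
\<close>

definition shelling_complex :: "nat \<Rightarrow> nat \<Rightarrow> nat set set" where
  "shelling_complex k i = (\<Union>j\<in>{0..i}. Pow ({0..k} - {j}))"

definition Phi_check :: "nat \<Rightarrow> nat \<Rightarrow> nat \<Rightarrow> ab_poly" where
  "Phi_check n k i =
     (if i = 0 then Psi_semi (shelling_complex k 0) n
      else Psi_semi (shelling_complex k i) n - Psi_semi (shelling_complex k (i - 1)) n)"


section \<open>Non-pure shellability and the h-triangle\<close>

text \<open>
  Facets are listed from index 0, so \<open>old_part Fs r\<close> is the intersection of
  the closure of the facet \<open>Fs ! r\<close> with the union of the closures of all earlier ones.
\<close>

definition old_part :: "'a set list \<Rightarrow> nat \<Rightarrow> 'a set set" where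
  "old_part Fs r = (\<Union>j<r. Pow (Fs ! j)) \<inter> Pow (Fs ! r)"

definition shelling_order :: "'a set set \<Rightarrow> 'a set list \<Rightarrow> bool" where
  "shelling_order K Fs \<longleftrightarrow>
     distinct Fs \<and> set Fs = facets K \<and>
     (complex_dim K = 0 \<or>
      complex_dim K \<ge> 1 \<and>
      (\<forall>r. 1 \<le> r \<and> r < length Fs \<longrightarrow> pure_of_dim (old_part Fs r) (face_dim (Fs ! r) - 1)))"

text \<open>The first component \<open>card (Fs ! r)\<close> is \<open>dim (Fs ! r) + 1\<close>.\<close>

definition shelling_type :: "'a set list \<Rightarrow> nat \<Rightarrow> nat \<times> nat" where
  "shelling_type Fs r = (card (Fs ! r), if r = 0 then 0 else card (facets (old_part Fs r)))"

text \<open>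
  The \<open>h\<close>-triangle, as read off from a shelling order. It depends only on the
  complex; a statement about it is made for every shelling order.
\<close>

definition h_triangle :: "'a set list \<Rightarrow> nat \<Rightarrow> nat \<Rightarrow> nat" where
  "h_triangle Fs k i = card {r. r < length Fs \<and> shelling_type Fs r = (k, i)}"

end

theory Submission
  imports Defs
begin

text \<open>
  The ab-index of the semisuspension is a linear function of the f-vector: the
  interval below a face \<open>F\<close> is Boolean, so the chains ending in \<open>F\<close> contribute an
  amount depending only on the cardinality of \<open>F\<close>, and the reduced Euler
  characteristic of the link of \<open>F\<close>, which enters through the pairs \<open>(F, *)\<close>,
  is a sum over the faces \<open>H\<close> above \<open>F\<close>; exchanging these two summations turns
  the ab-index into a sum over \<open>H\<close> of terms depending only on the cardinality
  of \<open>H\<close>. A facet of shelling type \<open>(k, i)\<close> adds a Boolean interval \<open>[R, F]\<close>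
  of new faces with \<open>card F = k\<close> and \<open>card R = i\<close>, and the faces of
  \<open>\<Delta>\<^bsub>k,i\<^esub>\<close> outside \<open>\<Delta>\<^bsub>k,i-1\<^esub>\<close> form an interval with the same two
  cardinalities.
\<close>

section \<open>The ab-index of a semisuspension and the f-vector\<close>

text \<open>Unlike in \<open>chain_weight\<close>, every step ends in \<open>var_b\<close>, the last
  one included: in a full chain the last face is still followed by \<open>Star\<close> or
  \<open>One\<close>.\<close>

fun chain_prefix :: "'a set list \<Rightarrow> ab_poly" where
  "chain_prefix (F # G # Fs) =
     (var_a - var_b) ^ (card G - card F - 1) * var_b * chain_prefix (G # Fs)"
| "chain_prefix _ = 1"

text \<open>No complex is mentioned: if \<open>F\<close> lies in a complex, so do all its subsets,
  and these are exactly the chains of faces from \<open>{}\<close> to \<open>F\<close>.\<close>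

definition chains_to :: "'a set \<Rightarrow> 'a set list set" where
  "chains_to F = {Fs. Fs \<noteq> [] \<and> hd Fs = {} \<and> last Fs = F \<and> sorted_wrt (\<subset>) Fs}"

text \<open>The set \<open>{..<m}\<close> serves as the standard set with \<open>m\<close>
  elements.\<close>

definition prefix_sum :: "nat \<Rightarrow> ab_poly" where
  "prefix_sum m = (\<Sum>Fs\<in>chains_to {..<m}. chain_prefix Fs)"

lemma sorted_wrt_psubset_last:
  assumes "sorted_wrt (\<subset>) Fs" "G \<in> set Fs"
  shows "G \<subseteq> last Fs"
  using assms
proof (induction Fs)
  case (Cons H Fs)
  show ?case
  proof (cases "Fs = []")
    case False
    then have "H \<subseteq> last Fs"
      using Cons.prems(1) by (simp add: psubset_imp_subset)
    then show ?thesis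
      using Cons False by auto
  qed (use Cons in simp)
qed simp

lemma chains_to_subset: "Fs \<in> chains_to F \<Longrightarrow> set Fs \<subseteq> Pow F"
  by (auto simp: chains_to_def dest: sorted_wrt_psubset_last)

lemma finite_chains_to:
  assumes "finite F"
  shows "finite (chains_to F)"
proof (rule finite_subset)
  have "distinct Fs" if "sorted_wrt (\<subset>) Fs" for Fs :: "'a set list"
    using that by (induction Fs) auto
  then have "distinct Fs" if "Fs \<in> chains_to F" for Fs
    using that by (simp add: chains_to_def)
  then show "chains_to F \<subseteq> {Fs. set Fs \<subseteq> Pow F \<and> distinct Fs}"
    by (auto dest: chains_to_subset)
  show "finite {Fs. set Fs \<subseteq> Pow F \<and> distinct Fs}"
    using assms by (intro finite_subset_distinct) simp
qed

lemma chain_prefix_map_image: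
  assumes "inj_on f A" "set Fs \<subseteq> Pow A"
  shows "chain_prefix (map ((`) f) Fs) = chain_prefix Fs"
  using assms(2)
proof (induction Fs rule: chain_prefix.induct)
  case (1 F G Fs)
  then have "card (f ` F) = card F" "card (f ` G) = card G"
    using assms(1) by (auto intro!: card_image intro: inj_on_subset)
  then show ?case
    using 1 by simp
qed auto

lemma map_image_chains_to:
  assumes f: "bij_betw f A B" and Fs: "Fs \<in> chains_to A"
  shows "map ((`) f) Fs \<in> chains_to B"
proof -
  have sub: "set Fs \<subseteq> Pow A"
    using chains_to_subset[OF Fs] .
  have "f ` F \<subset> f ` G" if "F \<subset> G" "F \<in> set Fs" "G \<in> set Fs" for F G
    using that sub f
    by (metis PowD bij_betw_def image_strict_mono inj_on_subset subsetD)
  then have "sorted_wrt (\<subset>) (map ((`) f) Fs)"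
    using Fs sorted_wrt_mono_rel[of Fs "(\<subset>)" "\<lambda>F G. f ` F \<subset> f ` G"]
    by (simp add: sorted_wrt_map chains_to_def)
  then show ?thesis
    using Fs f by (auto simp: chains_to_def hd_map last_map bij_betw_def)
qed

text \<open>A bijection from \<open>{..<card F}\<close> to \<open>F\<close> carries chains to chains
  and keeps all cardinalities, hence all weights. This is where the contribution of a face becomes a
  function of its cardinality.\<close>

lemma sum_chain_prefix:
  assumes "finite F"
  shows "(\<Sum>Fs\<in>chains_to F. chain_prefix Fs) = prefix_sum (card F)"
proof -
  obtain f where f: "bij_betw f {..<card F} F"
    using ex_bij_betw_nat_finite[OF assms] by (auto simp: atLeast0LessThan)
  define g where "g = inv_into {..<card F} f"
  have g: "bij_betw g F {..<card F}"
    using f by (simp add: g_def bij_betw_inv_into)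
  have gf: "map ((`) g) (map ((`) f) Fs) = Fs" if "Fs \<in> chains_to {..<card F}" for Fs
  proof -
    have "g ` f ` G = G" if "G \<subseteq> {..<card F}" for G
      using f that unfolding g_def by (simp add: bij_betw_def inv_into_image_cancel)
    then show ?thesis
      using chains_to_subset[OF that] by (auto intro!: map_idI)
  qed
  have fg: "map ((`) f) (map ((`) g) Fs) = Fs" if "Fs \<in> chains_to F" for Fs
  proof -
    have "f ` g ` G = G" if "G \<subseteq> F" for G
      using f that unfolding g_def by (simp add: bij_betw_def image_inv_into_cancel)
    then show ?thesis
      using chains_to_subset[OF that] by (auto intro!: map_idI)
  qed
  have "bij_betw (map ((`) f)) (chains_to {..<card F}) (chains_to F)"
    using map_image_chains_to[OF f] map_image_chains_to[OF g] fg gf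
    by (intro bij_betw_byWitness[where f' = "map ((`) g)"]) auto
  then have "(\<Sum>Fs\<in>chains_to F. chain_prefix Fs) =
      (\<Sum>Fs\<in>chains_to {..<card F}. chain_prefix (map ((`) f) Fs))"
    by (simp add: sum.reindex_bij_betw)
  also have "\<dots> = prefix_sum (card F)"
    unfolding prefix_sum_def
    using f chains_to_subset[of _ "{..<card F}"]
    by (intro sum.cong refl chain_prefix_map_image[of f "{..<card F}"]) (auto simp: bij_betw_def)
  finally show ?thesis .
qed

section \<open>Full chains of the semisuspension and their weights\<close>

lemma semi_poset_simps [simp]:
  "elts (semi_poset K n) = Face ` K \<union> {Star, One}"
  "lt (semi_poset K n) = semi_lt n"
  "rk (semi_poset K n) = semi_rk n"
  "qzeta (semi_poset K n) = semi_zeta K n"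
  by (simp_all add: semi_poset_def)

text \<open>Only \<open>One\<close> lies above \<open>Star\<close>, so \<open>Star\<close> can occur
  only directly before the final \<open>One\<close>; all other elements are faces. The two images
  are the chains avoiding \<open>Star\<close> and those passing through it.\<close>

lemma full_chains_semi_poset:
  assumes K: "simplicial_complex K" and n: "0 < n"
  shows "full_chains (semi_poset K n) =
    (\<lambda>Fs. map Face Fs @ [One]) ` (\<Union>F\<in>K. chains_to F) \<union>
    (\<lambda>Fs. map Face Fs @ [Star, One]) ` (\<Union>F\<in>{F\<in>K. card F < n}. chains_to F)"
    (is "?C = ?A \<union> ?B")
proof
  note defs = full_chains_def bottom_semi_poset[OF K n] top_semi_poset
  have sub: "set Fs \<subseteq> K" if "Fs \<in> chains_to F" "F \<in> K" for Fs F
    using chains_to_subset[OF that(1)] that(2) K by (auto simp: simplicial_complex_def)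
  have mono: "card F \<le> card G" if "F \<subseteq> G" "G \<in> K" for F G
    using that K by (auto simp: simplicial_complex_def intro: card_mono)
  show "?A \<union> ?B \<subseteq> ?C"
  proof
    fix xs assume "xs \<in> ?A \<union> ?B"
    then consider Fs F where "xs = map Face Fs @ [One]" "F \<in> K" "Fs \<in> chains_to F"
      | Fs F where "xs = map Face Fs @ [Star, One]" "F \<in> K" "card F < n" "Fs \<in> chains_to F"
      by auto
    then show "xs \<in> ?C"
    proof cases
      case 1
      then show ?thesis
        using sub[OF 1(3,2)]
        by (auto simp: defs chains_to_def sorted_wrt_append sorted_wrt_map
            hd_append hd_map)
    next
      case 2
      \<comment> \<open>Cardinality grows along the chain, so the bound on \<open>F\<close> puts
        every face of the chain below \<open>Star\<close>.\<close>
      have "card G < n" if "G \<in> set Fs" for G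
        using mono[of G F] chains_to_subset[OF 2(4)] that 2(2,3) by fastforce
      then show ?thesis
        using 2 sub[OF 2(4,2)]
        by (auto simp: defs chains_to_def sorted_wrt_append sorted_wrt_map
            hd_append hd_map)
    qed
  qed
  show "?C \<subseteq> ?A \<union> ?B"
  proof
    fix xs assume xs: "xs \<in> ?C"
    have ne: "xs \<noteq> []" and hd: "hd xs = Face {}" and last: "last xs = One"
      and elts: "set xs \<subseteq> Face ` K \<union> {Star, One}" and srt: "sorted_wrt (semi_lt n) xs"
      using xs by (simp_all add: defs)
    obtain ys where ys: "xs = ys @ [One]"
      using ne last by (metis append_butlast_last_id)
    have ys_ne: "ys \<noteq> []"
      using hd ys by auto
    have ys_lt: "sorted_wrt (semi_lt n) ys" "\<And>y. y \<in> set ys \<Longrightarrow> semi_lt n y One"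
      using srt ys by (auto simp: sorted_wrt_append)
    obtain zs z where zs: "ys = zs @ [z]"
      using ys_ne by (metis append_butlast_last_id)
    have zs_lt: "sorted_wrt (semi_lt n) zs" "\<And>y. y \<in> set zs \<Longrightarrow> semi_lt n y z"
      using ys_lt(1) zs by (auto simp: sorted_wrt_append)
    have z: "z \<noteq> One"
      using ys_lt(2)[of z] zs by auto
    \<comment> \<open>\<open>Star\<close> has only \<open>One\<close> above it and
      \<open>One\<close> has nothing; as \<open>z\<close> is not \<open>One\<close>, all elements
      before \<open>z\<close> are faces.\<close>
    have "\<exists>F. y = Face F" if "y \<in> set zs" for y
      using zs_lt(2)[OF that] z by (cases y; cases z) auto
    then obtain Fs where Fs: "zs = map Face Fs"
      by (metis ex_map_conv)
    show "xs \<in> ?A \<union> ?B"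
    proof (cases z)
      case Star
      then have ne': "Fs \<noteq> []"
        using hd ys zs Fs by auto
      have "Fs \<in> chains_to (last Fs)"
        using hd ys zs zs_lt(1) Fs ne'
        by (auto simp: chains_to_def sorted_wrt_map hd_append hd_map)
      moreover have "last Fs \<in> K" "card (last Fs) < n"
        using elts ys zs Fs zs_lt(2)[of "Face (last Fs)"] Star last_in_set[OF ne'] by auto
      ultimately show ?thesis
        using ys zs Fs Star by auto
    next
      case (Face F)
      have "sorted_wrt (semi_lt n) (map Face (Fs @ [F]))"
        using ys_lt(1) zs Fs Face by simp
      then have "Fs @ [F] \<in> chains_to F"
        using hd ys zs Fs Face
        by (cases Fs) (auto simp: chains_to_def sorted_wrt_append sorted_wrt_map)
      moreover have "F \<in> K"
        using elts ys zs Face by auto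
      ultimately show ?thesis
        using ys zs Fs Face by (intro UnI1 image_eqI[of _ _ "Fs @ [F]"]) auto
    qed (use z in simp)
  qed
qed

lemma chain_weight_Cons_Cons:
  assumes "zs \<noteq> []"
  shows "chain_weight P (x # y # zs) =
    (var_a - var_b) ^ (rk P y - rk P x - 1) * var_b * chain_weight P (y # zs)"
  using assms by (cases zs) simp_all

text \<open>The rank of \<open>One\<close> is \<open>n + 1\<close>, which cancels the
  \<open>- 1\<close> in the exponent.\<close>

lemma chain_weight_One:
  assumes "Fs \<noteq> []"
  shows "chain_weight (semi_poset K n) (map Face Fs @ [One]) =
    chain_prefix Fs * (var_a - var_b) ^ (n - card (last Fs))"
  using assms
  by (induction Fs rule: chain_prefix.induct) (auto simp: chain_weight_Cons_Cons mult.assoc)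

text \<open>The step from \<open>Star\<close> to \<open>One\<close> has rank difference 1 and
  contributes the factor 1.\<close>

lemma chain_weight_Star_One:
  assumes "Fs \<noteq> []"
  shows "chain_weight (semi_poset K n) (map Face Fs @ [Star, One]) =
    chain_prefix Fs * ((var_a - var_b) ^ (n - card (last Fs) - 1) * var_b)"
  using assms
  by (induction Fs rule: chain_prefix.induct) (auto simp: chain_weight_Cons_Cons mult.assoc)

lemma chain_zeta_One:
  "chain_zeta (semi_poset K n) (map Face Fs @ [One]) = 1"
  by (induction Fs rule: chain_prefix.induct) auto

lemma chain_zeta_Star_One:
  assumes "Fs \<noteq> []"
  shows "chain_zeta (semi_poset K n) (map Face Fs @ [Star, One]) =
    semi_zeta K n (Face (last Fs)) Star"
  using assms by (induction Fs rule: chain_prefix.induct) auto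

text \<open>The sets \<open>chains_to F\<close> are disjoint, since the last entry recovers
  \<open>F\<close>. The first argument of \<open>h\<close> lets a weight depend on that
  entry.\<close>

lemma sum_chains_to_Union:
  assumes "finite K" "\<And>F. F \<in> K \<Longrightarrow> finite F"
  shows "(\<Sum>Fs\<in>(\<Union>F\<in>K. chains_to F). h (last Fs) Fs) = (\<Sum>F\<in>K. \<Sum>Fs\<in>chains_to F. h F Fs)"
proof -
  have "(\<Sum>Fs\<in>(\<Union>F\<in>K. chains_to F). h (last Fs) Fs) =
      (\<Sum>F\<in>K. \<Sum>Fs\<in>chains_to F. h (last Fs) Fs)"
    using assms finite_chains_to
    by (intro sum.UNION_disjoint) (auto simp: chains_to_def)
  then show ?thesis
    by (simp add: chains_to_def)
qed

text \<open>
  In \<open>face_term\<close>, the sum over \<open>F\<close> collects what a face of cardinality \<open>m\<close>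
  contributes to the Euler characteristics of the links of its subfaces \<open>F\<close>.
\<close>

definition top_term :: "nat \<Rightarrow> nat \<Rightarrow> ab_poly" where
  "top_term n m = prefix_sum m * (var_a - var_b) ^ (n - m)"

text \<open>The value 0 for \<open>m \<ge> n\<close> reflects that faces of dimension
  \<open>n - 1\<close> are not below \<open>Star\<close>; sums may then range over all
  faces.\<close>

definition star_term :: "nat \<Rightarrow> nat \<Rightarrow> ab_poly" where
  "star_term n m =
     (if m < n then prefix_sum m * ((var_a - var_b) ^ (n - m - 1) * var_b) else 0)"

definition face_term :: "nat \<Rightarrow> nat \<Rightarrow> ab_poly" where
  "face_term n m = top_term n m + star_term n m +
     (\<Sum>F\<in>Pow {..<m}. of_int ((-1) ^ (n - card F) * (-1) ^ (m - card F + 1)) * star_term n (card F))"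

section \<open>The ab-index as a sum over the faces\<close>

lemma sum_Pow_card:
  assumes "finite F"
  shows "(\<Sum>T\<in>Pow {..<card F}. h (card T)) = (\<Sum>T\<in>Pow F. h (card T))"
proof -
  obtain f where f: "bij_betw f {..<card F} F"
    using ex_bij_betw_nat_finite[OF assms] by (auto simp: atLeast0LessThan)
  have "card (f ` T) = card T" if "T \<subseteq> {..<card F}" for T
    using f that by (meson bij_betw_def card_image inj_on_subset)
  then have "(\<Sum>T\<in>Pow {..<card F}. h (card T)) = (\<Sum>T\<in>Pow {..<card F}. h (card (f ` T)))"
    by simp
  also have "\<dots> = (\<Sum>T\<in>Pow F. h (card T))"
    using sum.reindex_bij_betw[OF bij_betw_Pow[OF f], of "\<lambda>T. h (card T)"] .
  finally show ?thesis .
qed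

text \<open>The full chains are split by whether they contain \<open>Star\<close> and then grouped
  by their last face; the only nontrivial value of \<open>semi_zeta\<close> on a chain is the one at
  its last face and \<open>Star\<close>.\<close>

lemma Psi_semi_chains:
  assumes K: "simplicial_complex K" and n: "0 < n"
  shows "Psi_semi K n = (\<Sum>F\<in>K. top_term n (card F)) +
    (\<Sum>F\<in>K. of_int (semi_zeta K n (Face F) Star) * star_term n (card F))"
proof -
  have fin: "finite K" "\<And>F. F \<in> K \<Longrightarrow> finite F"
    using K by (auto simp: simplicial_complex_def)
  define P where "P = semi_poset K n"
  define K' where "K' = {F \<in> K. card F < n}"
  define D where "D = (\<Union>F\<in>K. chains_to F)"
  define D' where "D' = (\<Union>F\<in>K'. chains_to F)"
  define w where "w xs = of_int (chain_zeta P xs) * chain_weight P xs" for xs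
  have K': "finite K'" "\<And>F. F \<in> K' \<Longrightarrow> finite F" "K' \<subseteq> K"
    using fin by (auto simp: K'_def)
  have finD: "finite D" "finite D'"
    using fin K' finite_chains_to by (auto simp: D_def D'_def)
  have ne: "Fs \<noteq> []" if "Fs \<in> D \<or> Fs \<in> D'" for Fs
    using that by (auto simp: D_def D'_def chains_to_def)
  have face_inj: "inj (map (Face :: 'a set \<Rightarrow> _))"
    by (simp add: inj_def)
  have "Psi_semi K n = (\<Sum>xs\<in>(\<lambda>Fs. map Face Fs @ [One]) ` D \<union>
      (\<lambda>Fs. map Face Fs @ [Star, One]) ` D'. w xs)"
    unfolding Psi_semi_def ab_index_def full_chains_semi_poset[OF K n] D_def D'_def K'_def w_def P_def ..
  also have "\<dots> = (\<Sum>xs\<in>(\<lambda>Fs. map Face Fs @ [One]) ` D. w xs) +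
      (\<Sum>xs\<in>(\<lambda>Fs. map Face Fs @ [Star, One]) ` D'. w xs)"
  proof (rule sum.union_disjoint)
    have "map Face Fs @ [One] \<noteq> map Face Gs @ [Star, One]" for Fs Gs :: "'a set list"
    proof
      assume "map Face Fs @ [One] = map Face Gs @ [Star, One]"
      then have "map Face Fs = map Face Gs @ [Star]"
        by simp
      then have "Star \<in> set (map Face Fs)"
        by simp
      then show False
        by auto
    qed
    then show "(\<lambda>Fs. map Face Fs @ [One]) ` D \<inter> (\<lambda>Fs. map Face Fs @ [Star, One]) ` D' = {}"
      by blast
  qed (use finD in auto)
  also have "(\<Sum>xs\<in>(\<lambda>Fs. map Face Fs @ [One]) ` D. w xs) =
      (\<Sum>Fs\<in>D. w (map Face Fs @ [One]))"
    using face_inj by (subst sum.reindex) (auto simp: inj_on_def)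
  also have "\<dots> = (\<Sum>Fs\<in>D. chain_prefix Fs * (var_a - var_b) ^ (n - card (last Fs)))"
    using ne by (intro sum.cong) (auto simp: w_def P_def chain_weight_One chain_zeta_One)
  also have "\<dots> = (\<Sum>F\<in>K. top_term n (card F))"
    unfolding D_def
    using fin sum_chains_to_Union[OF fin,
        of "\<lambda>F Fs. chain_prefix Fs * (var_a - var_b) ^ (n - card F)"]
    by (simp add: top_term_def sum_chain_prefix flip: sum_distrib_right)
  also have "(\<Sum>xs\<in>(\<lambda>Fs. map Face Fs @ [Star, One]) ` D'. w xs) =
      (\<Sum>Fs\<in>D'. w (map Face Fs @ [Star, One]))"
    using face_inj by (subst sum.reindex) (auto simp: inj_on_def)
  also have "\<dots> = (\<Sum>Fs\<in>D'. of_int (semi_zeta K n (Face (last Fs)) Star) *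
      (chain_prefix Fs * ((var_a - var_b) ^ (n - card (last Fs) - 1) * var_b)))"
    using ne by (intro sum.cong)
      (auto simp: w_def P_def chain_weight_Star_One chain_zeta_Star_One simp del: semi_zeta.simps)
  also have "\<dots> = (\<Sum>F\<in>K'. of_int (semi_zeta K n (Face F) Star) * star_term n (card F))"
    unfolding D'_def
  proof (subst sum_chains_to_Union[OF K'(1,2)], assumption, rule sum.cong)
    fix F assume F: "F \<in> K'"
    let ?z = "of_int (semi_zeta K n (Face F) Star) :: ab_poly"
    let ?q = "(var_a - var_b) ^ (n - card F - 1) * var_b"
    have "(\<Sum>Fs\<in>chains_to F. ?z * (chain_prefix Fs * ?q)) =
        ?z * ((\<Sum>Fs\<in>chains_to F. chain_prefix Fs) * ?q)"
      by (simp only: sum_distrib_left sum_distrib_right)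
    also have "\<dots> = ?z * star_term n (card F)"
      using F sum_chain_prefix[OF K'(2)[OF F]] by (simp only: star_term_def K'_def) simp
    finally show "(\<Sum>Fs\<in>chains_to F. ?z * (chain_prefix Fs * ?q)) = ?z * star_term n (card F)" .
  qed simp
  \<comment> \<open>The faces with \<open>n\<close> or more elements come back in, since
    \<open>star_term\<close> vanishes there.\<close>
  also have "\<dots> = (\<Sum>F\<in>K. of_int (semi_zeta K n (Face F) Star) * star_term n (card F))"
    using fin by (intro sum.mono_neutral_left) (auto simp: K'_def star_term_def)
  finally show ?thesis .
qed

lemma Psi_semi_f_vector:
  assumes K: "simplicial_complex K" and n: "0 < n"
  shows "Psi_semi K n = (\<Sum>H\<in>K. face_term n (card H))"
proof -
  have fin: "finite K" "\<And>F. F \<in> K \<Longrightarrow> finite F"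
    and down: "\<And>F G. F \<in> K \<Longrightarrow> G \<subseteq> F \<Longrightarrow> G \<in> K"
    using K by (auto simp: simplicial_complex_def)
  define s where "s F H =
    of_int ((-1) ^ (n - card F) * (-1) ^ (card H - card F + 1)) * star_term n (card F)"
    for F H :: "'a set"
  have "(\<Sum>F\<in>K. of_int (semi_zeta K n (Face F) Star) * star_term n (card F)) =
      (\<Sum>F\<in>K. star_term n (card F)) + (\<Sum>F\<in>K. \<Sum>H\<in>{H\<in>K. F \<subseteq> H}. s F H)"
    unfolding s_def by (simp add: link_euler_def distrib_right sum.distrib sum_distrib_left
        sum_distrib_right)
  also have "(\<Sum>F\<in>K. \<Sum>H\<in>{H\<in>K. F \<subseteq> H}. s F H) = (\<Sum>H\<in>K. \<Sum>F\<in>{F\<in>K. F \<subseteq> H}. s F H)"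
    using fin(1) by (rule sum.swap_restrict) (rule fin(1))
  \<comment> \<open>All subsets of \<open>H\<close> are faces, so the inner sum no longer depends on
    \<open>K\<close>; it only sees cardinalities, and \<open>H\<close> can be replaced by
    \<open>{..<card H}\<close>.\<close>
  also have "\<dots> = (\<Sum>H\<in>K. \<Sum>F\<in>Pow H. s F H)"
    using down by (intro sum.cong) auto
  also have "\<dots> = (\<Sum>H\<in>K. \<Sum>F\<in>Pow {..<card H}.
      of_int ((-1) ^ (n - card F) * (-1) ^ (card H - card F + 1)) * star_term n (card F))"
    unfolding s_def using fin(2) by (intro sum.cong refl sum_Pow_card[symmetric])
  finally show ?thesis
    unfolding Psi_semi_chains[OF K n] face_term_def sum.distrib by (simp add: add.assoc)
qed

section \<open>Shellings\<close>

text \<open>The interval from \<open>R\<close> to \<open>F\<close> is the power set of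
  \<open>F - R\<close>, shifted by the union with \<open>R\<close>, which raises every cardinality
  by \<open>card R\<close>.\<close>

lemma sum_Pow_above:
  assumes "finite F" "R \<subseteq> F"
  shows "(\<Sum>H\<in>{H. R \<subseteq> H \<and> H \<subseteq> F}. h (card H)) =
    (\<Sum>T\<in>Pow {..<card F - card R}. h (card T + card R))"
proof -
  have R: "finite R"
    using assms finite_subset by blast
  have bij: "bij_betw (\<lambda>T. T \<union> R) (Pow (F - R)) {H. R \<subseteq> H \<and> H \<subseteq> F}"
    using assms by (intro bij_betw_byWitness[where f' = "\<lambda>H. H - R"]) auto
  have "(\<Sum>H\<in>{H. R \<subseteq> H \<and> H \<subseteq> F}. h (card H)) = (\<Sum>T\<in>Pow (F - R). h (card (T \<union> R)))"
    by (rule sum.reindex_bij_betw[OF bij, of "\<lambda>H. h (card H)", symmetric])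
  also have "\<dots> = (\<Sum>T\<in>Pow (F - R). h (card T + card R))"
  proof (rule sum.cong)
    fix T assume "T \<in> Pow (F - R)"
    then show "h (card (T \<union> R)) = h (card T + card R)"
      using assms R finite_subset[of T F] by (subst card_Un_disjoint) auto
  qed simp
  also have "\<dots> = (\<Sum>T\<in>Pow {..<card (F - R)}. h (card T + card R))"
    using sum_Pow_card[of "F - R" "\<lambda>m. h (m + card R)"] assms by simp
  finally show ?thesis
    using assms R by (simp add: card_Diff_subset)
qed

lemma simplicial_complex_shelling_complex: "simplicial_complex (shelling_complex k i)"
  unfolding simplicial_complex_def shelling_complex_def
  by (auto dest: finite_subset)

text \<open>By the face-sum formula, the difference of the two indices is a sum over the faces added
  by the last facet. These contain all vertices below \<open>i\<close>, and so form the interval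
  from \<open>{0..<i}\<close> to that facet.\<close>

lemma Phi_check_eq:
  assumes "0 < n" "i \<le> k"
  shows "Phi_check n k i = (\<Sum>T\<in>Pow {..<k - i}. face_term n (card T + i))"
proof -
  define h where "h = face_term n"
  \<comment> \<open>The facet opposite to the vertex \<open>i\<close>, the last one to enter
    \<open>shelling_complex k i\<close>.\<close>
  define F where "F = {0..k} - {i}"
  have F: "finite F" "{0..<i} \<subseteq> F" "card F = k"
    using assms(2) by (auto simp: F_def)
  have above: "(\<Sum>H\<in>{H. {0..<i} \<subseteq> H \<and> H \<subseteq> F}. h (card H)) =
      (\<Sum>T\<in>Pow {..<k - i}. h (card T + i))"
    using sum_Pow_above[OF F(1,2), of h] F(3) by simp
  have Psi: "Psi_semi (shelling_complex k j) n = (\<Sum>H\<in>shelling_complex k j. h (card H))" for j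
    unfolding h_def using Psi_semi_f_vector[OF simplicial_complex_shelling_complex assms(1)] .
  have fin: "finite (shelling_complex k j)" for j
    using simplicial_complex_shelling_complex by (simp add: simplicial_complex_def)
  show ?thesis
  proof (cases "i = 0")
    case True
    then have "shelling_complex k i = {H. {0..<i} \<subseteq> H \<and> H \<subseteq> F}"
      by (auto simp: shelling_complex_def F_def)
    then show ?thesis
      using above True Psi[of 0] by (simp add: Phi_check_def h_def)
  next
    case False
    have sub: "shelling_complex k (i - 1) \<subseteq> shelling_complex k i"
      unfolding shelling_complex_def by (intro UN_mono) auto
    have "{0..i} = insert i {0..i - 1}"
      using False by auto
    then have "shelling_complex k i = Pow F \<union> shelling_complex k (i - 1)"
      by (simp add: shelling_complex_def F_def)
    \<comment> \<open>A subset of \<open>F\<close> is an old face exactly if it misses one of the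
      vertices below \<open>i\<close>.\<close>
    moreover have "H \<in> shelling_complex k (i - 1) \<longleftrightarrow> \<not> {0..<i} \<subseteq> H" if H: "H \<subseteq> F" for H
    proof -
      have "H \<in> shelling_complex k (i - 1) \<longleftrightarrow> (\<exists>j\<le>i - 1. j \<notin> H)"
        using H by (fastforce simp: shelling_complex_def F_def)
      also have "\<dots> \<longleftrightarrow> (\<exists>j<i. j \<notin> H)"
        using False by (metis Suc_pred' less_Suc_eq_le neq0_conv)
      also have "\<dots> \<longleftrightarrow> \<not> {0..<i} \<subseteq> H"
        by auto
      finally show ?thesis .
    qed
    ultimately have diff: "shelling_complex k i - shelling_complex k (i - 1) =
        {H. {0..<i} \<subseteq> H \<and> H \<subseteq> F}"
      by auto
    have "Phi_check n k i =
        (\<Sum>H\<in>shelling_complex k i - shelling_complex k (i - 1). h (card H))"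
      using False sum_diff[OF fin sub, of "\<lambda>H. h (card H)"] by (simp add: Phi_check_def Psi)
    then show ?thesis
      using above unfolding diff h_def by simp
  qed
qed

section \<open>The restriction of a facet\<close>

lemma facet_above:
  assumes "finite K" "F \<in> K"
  obtains G where "G \<in> facets K" "F \<subseteq> G"
proof -
  obtain G where "G \<in> K" "F \<subseteq> G" "\<And>H. H \<in> K \<Longrightarrow> G \<subseteq> H \<Longrightarrow> G = H"
    using finite_has_maximal2[OF assms] by metis
  then show ?thesis
    using that[of G] by (auto simp: facets_def)
qed

text \<open>
  The set \<open>R\<close> is the restriction of the facet: the smallest face that its
  addition creates.
\<close>

lemma restriction_set:
  assumes F: "finite F" and sub: "L \<subseteq> Pow F"
    and down: "\<And>G H. G \<in> L \<Longrightarrow> H \<subseteq> G \<Longrightarrow> H \<in> L"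
    and pure: "\<And>G. G \<in> facets L \<Longrightarrow> face_dim G = face_dim F - 1"
  obtains R where "R \<subseteq> F" "card R = card (facets L)" "Pow F - L = {H. R \<subseteq> H \<and> H \<subseteq> F}"
proof -
  \<comment> \<open>The vertices whose opposite codimension-one face of \<open>F\<close> is already
    present. If \<open>L\<close> is empty, as for the first facet, then \<open>R\<close> is
    empty.\<close>
  define R where "R = {v \<in> F. F - {v} \<in> L}"
  have finL: "finite L"
    using F sub finite_subset by blast
  have facet: "\<exists>v\<in>R. G = F - {v}" if G: "G \<in> facets L" for G
  proof -
    have GL: "G \<in> L" and GF: "G \<subseteq> F"
      using G sub by (auto simp: facets_def)
    \<comment> \<open>Purity enters here: a facet of \<open>L\<close> omits exactly one vertex of
      \<open>F\<close>.\<close>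
    have "card (F - G) = 1"
      using pure[OF G] GF F finite_subset[OF GF F] card_mono[OF F GF]
      by (simp add: face_dim_def card_Diff_subset)
    then obtain v where v: "F - G = {v}"
      by (auto simp: card_1_singleton_iff)
    then have "G = F - {v}"
      using GF by auto
    then show ?thesis
      using v GL by (auto simp: R_def)
  qed
  \<comment> \<open>A facet of \<open>L\<close> above \<open>F - {v}\<close> has the form
    \<open>F - {u}\<close>, and the inclusion forces \<open>u = v\<close>. Thus the facets of
    \<open>L\<close> correspond to the elements of \<open>R\<close>.\<close>
  have "F - {v} \<in> facets L" if v: "v \<in> R" for v
  proof -
    obtain G where G: "G \<in> facets L" "F - {v} \<subseteq> G"
      using facet_above[OF finL] v by (auto simp: R_def)
    then obtain u where "u \<in> R" "G = F - {u}"
      using facet by blast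
    then have "F - {v} = G"
      using G(2) v by (auto simp: R_def)
    then show ?thesis
      using G(1) by simp
  qed
  then have "facets L = (\<lambda>v. F - {v}) ` R"
    using facet by auto
  moreover have "inj_on (\<lambda>v. F - {v}) R"
    by (auto simp: inj_on_def R_def)
  ultimately have "card R = card (facets L)"
    by (simp add: card_image)
  moreover have "H \<in> L \<longleftrightarrow> \<not> R \<subseteq> H" if H: "H \<subseteq> F" for H
  proof
    assume "H \<in> L"
    then obtain G where "G \<in> facets L" "H \<subseteq> G"
      using facet_above[OF finL] by blast
    then show "\<not> R \<subseteq> H"
      using facet by blast
  next
    assume "\<not> R \<subseteq> H"
    then obtain v where "v \<in> R" "H \<subseteq> F - {v}"
      using H by blast
    then show "H \<in> L"
      using down by (auto simp: R_def)
  qed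
  then have "Pow F - L = {H. R \<subseteq> H \<and> H \<subseteq> F}"
    by auto
  moreover have "R \<subseteq> F"
    by (auto simp: R_def)
  ultimately show ?thesis
    using that by blast
qed

section \<open>The faces added by one facet of a shelling\<close>

text \<open>In dimension 0 the purity condition is not part of the definition and has to be derived:
  the facets are distinct single vertices, so they meet only in \<open>{}\<close>, whose dimension
  is -1.\<close>

lemma shelling_order_pure:
  assumes K: "simplicial_complex K" and Fs: "shelling_order K Fs"
    and r: "1 \<le> r" "r < length Fs"
  shows "pure_of_dim (old_part Fs r) (face_dim (Fs ! r) - 1)"
proof (cases "complex_dim K = 0")
  case False
  then show ?thesis
    using Fs r by (auto simp: shelling_order_def)
next
  case True
  have fin: "finite K" "\<And>F. F \<in> K \<Longrightarrow> finite F" "{} \<in> K"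
    using K by (auto simp: simplicial_complex_def)
  have dist: "distinct Fs" and facets: "set Fs = facets K"
    using Fs by (simp_all add: shelling_order_def)
  \<comment> \<open>Dimension 0 provides a vertex \<open>E\<close>, which keeps \<open>{}\<close>
    from being a facet.\<close>
  have "Max (face_dim ` K) \<in> face_dim ` K"
    using fin by (intro Max_in) auto
  then obtain E where E: "E \<in> K" "card E = 1"
    using True by (auto simp: complex_dim_def face_dim_def)
  have le: "card F \<le> 1" if "F \<in> K" for F
    using face_card_le[OF K _ that, of 1] True by simp
  have one: "card (Fs ! j) = 1" if "j < length Fs" for j
  proof -
    have facet: "Fs ! j \<in> facets K"
      using nth_mem[OF that] facets by simp
    have in_K: "Fs ! j \<in> K"
      using facet unfolding facets_def by blast
    have "Fs ! j \<noteq> {}"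
    proof
      assume "Fs ! j = {}"
      then have "E = {}"
        using facet E(1) unfolding facets_def by blast
      then show False
        using E(2) by simp
    qed
    then have "card (Fs ! j) \<noteq> 0"
      using fin(2)[OF in_K] by simp
    moreover have "card (Fs ! j) \<le> 1"
      using le[OF in_K] .
    ultimately show ?thesis
      by linarith
  qed
  obtain v where v: "Fs ! r = {v}"
    using one[OF r(2)] by (auto simp: card_1_singleton_iff)
  have "v \<notin> Fs ! j" if "j < r" for j
  proof
    assume "v \<in> Fs ! j"
    moreover have "card (Fs ! j) = 1"
      using one[of j] that r by linarith
    then obtain u where "Fs ! j = {u}"
      by (auto simp: card_1_singleton_iff)
    ultimately have "Fs ! j = Fs ! r"
      using v by simp
    then show False
      using dist that r nth_eq_iff_index_eq[of Fs j r] by simp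
  qed
  then have meet: "Pow (Fs ! j) \<inter> Pow (Fs ! r) = {{}}" if "j < r" for j
    using that by (simp add: v flip: Pow_Int_eq)
  have "old_part Fs r = (\<Union>j<r. Pow (Fs ! j) \<inter> Pow (Fs ! r))"
    unfolding old_part_def by blast
  also have "\<dots> = (\<Union>j<r. {{}})"
    by (rule SUP_cong) (simp_all only: lessThan_iff meet)
  \<comment> \<open>The bound \<open>1 \<le> r\<close> makes the index set nonempty.\<close>
  also have "\<dots> = {{}}"
    using r(1) by (simp add: lessThan_empty_iff)
  finally have "old_part Fs r = {{}}" .
  then show ?thesis
    by (simp add: pure_of_dim_def facets_def v face_dim_def)
qed

text \<open>The new faces form the interval from the restriction to the facet, with bottom of
  cardinality \<open>i\<close> and top of cardinality \<open>k\<close>. For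
  \<open>h = face_term n\<close> the right-hand side is the one in
  \<open>Phi_check_eq\<close>.\<close>

lemma shelling_step:
  assumes K: "simplicial_complex K" and Fs: "shelling_order K Fs"
    and r: "r < length Fs" and type: "shelling_type Fs r = (k, i)"
  shows "i \<le> k"
    and "(\<Sum>H\<in>Pow (Fs ! r) - (\<Union>j<r. Pow (Fs ! j)). h (card H)) =
      (\<Sum>T\<in>Pow {..<k - i}. h (card T + i))"
proof -
  define F where "F = Fs ! r"
  define L where "L = old_part Fs r"
  have "F \<in> K"
    using Fs r nth_mem[OF r] by (auto simp: shelling_order_def facets_def F_def)
  then have F: "finite F"
    using K by (auto simp: simplicial_complex_def)
  \<comment> \<open>For \<open>r = 0\<close> the old part is empty and has no facets, in agreement
    with the value 0 set in \<open>shelling_type\<close>.\<close>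
  have i: "i = card (facets L)"
    using type by (auto simp: shelling_type_def L_def old_part_def facets_def)
  have pure: "face_dim G = face_dim F - 1" if "G \<in> facets L" for G
  proof (cases "r = 0")
    case True
    then show ?thesis
      using that by (simp add: L_def old_part_def facets_def)
  next
    case False
    then show ?thesis
      using shelling_order_pure[OF K Fs _ r] that by (simp add: pure_of_dim_def L_def F_def)
  qed
  obtain R where R: "R \<subseteq> F" "card R = card (facets L)" "Pow F - L = {H. R \<subseteq> H \<and> H \<subseteq> F}"
  proof (rule restriction_set[OF F])
    show "L \<subseteq> Pow F"
      by (auto simp: L_def F_def old_part_def)
    show "H \<in> L" if "G \<in> L" "H \<subseteq> G" for G H
      using that unfolding L_def old_part_def by blast
  qed (use pure in auto)
  have k: "k = card F"
    using type by (simp add: shelling_type_def F_def)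
  show "i \<le> k"
    using card_mono[OF F R(1)] R(2) i k by simp
  have "Pow (Fs ! r) - (\<Union>j<r. Pow (Fs ! j)) = Pow F - L"
    by (auto simp: F_def L_def old_part_def)
  then show "(\<Sum>H\<in>Pow (Fs ! r) - (\<Union>j<r. Pow (Fs ! j)). h (card H)) =
      (\<Sum>T\<in>Pow {..<k - i}. h (card T + i))"
    using sum_Pow_above[OF F R(1), of h] R(2) i k by (simp add: R(3))
qed

section \<open>Summation over the shelling\<close>

text \<open>Each element is charged to the first set that contains it.\<close>

lemma sum_UN_lessThan:
  fixes A :: "nat \<Rightarrow> 'b set"
  assumes "\<And>r. r < m \<Longrightarrow> finite (A r)"
  shows "(\<Sum>x\<in>(\<Union>r<m. A r). g x) = (\<Sum>r<m. \<Sum>x\<in>A r - (\<Union>j<r. A j). g x)"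
  using assms
proof (induction m)
  case (Suc m)
  have "(\<Union>r<Suc m. A r) = (\<Union>r<m. A r) \<union> (A m - (\<Union>r<m. A r))"
    by (auto simp: lessThan_Suc)
  moreover have "(\<Sum>x\<in>(\<Union>r<m. A r) \<union> (A m - (\<Union>r<m. A r)). g x) =
      (\<Sum>x\<in>(\<Union>r<m. A r). g x) + (\<Sum>x\<in>A m - (\<Union>r<m. A r). g x)"
    using Suc.prems by (intro sum.union_disjoint) auto
  ultimately show ?case
    using Suc by simp
qed simp

lemma Union_Pow_facets:
  assumes "simplicial_complex K"
  shows "(\<Union>F\<in>facets K. Pow F) = K"
proof
  show "(\<Union>F\<in>facets K. Pow F) \<subseteq> K"
    using assms by (auto simp: simplicial_complex_def facets_def)
  show "K \<subseteq> (\<Union>F\<in>facets K. Pow F)"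
  proof
    fix F assume "F \<in> K"
    moreover have "finite K"
      using assms by (simp add: simplicial_complex_def)
    ultimately obtain G where "G \<in> facets K" "F \<subseteq> G"
      using facet_above by blast
    then show "F \<in> (\<Union>F\<in>facets K. Pow F)"
      by blast
  qed
qed

theorem theorem14p3:
  fixes \<Delta> :: "'a set set" and n :: nat and Fs :: "'a set list"
  assumes "n \<ge> 1"
    and "simplicial_complex \<Delta>"
    and "complex_dim \<Delta> < int n"
    and "shelling_order \<Delta> Fs"
  shows "Psi_semi \<Delta> n =
    (\<Sum>k=0..n. \<Sum>i=0..k. of_nat (h_triangle Fs k i) * Phi_check n k i)"
proof -
  have n: "0 < n"
    using assms(1) by simp
  define m where "m = length Fs"
  define I where "I = (SIGMA k:{0..n}. {0..k})"
  have facet: "Fs ! r \<in> \<Delta>" if "r < m" for r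
    using assms(4) nth_mem[of r Fs] that by (auto simp: shelling_order_def facets_def m_def)
  have fin: "finite (Fs ! r)" if "r < m" for r
    using facet[OF that] assms(2) by (simp add: simplicial_complex_def)
  \<comment> \<open>All types lie in the index triangle, so grouping the facets by type over
    \<open>I\<close> loses none of them.\<close>
  have type: "shelling_type Fs r \<in> I" if r: "r < m" for r
  proof -
    obtain k i where ki: "shelling_type Fs r = (k, i)"
      by fastforce
    have "i \<le> k"
      using shelling_step(1)[OF assms(2,4) _ ki] r by (simp add: m_def)
    moreover have "k \<le> n"
      using face_card_le[OF assms(2,3) facet[OF r]] ki by (simp add: shelling_type_def)
    ultimately show ?thesis
      by (simp add: I_def ki)
  qed
  have "set Fs = (!) Fs ` {..<m}"
    by (auto simp: m_def set_conv_nth)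
  then have "facets \<Delta> = (!) Fs ` {..<m}"
    using assms(4) by (simp add: shelling_order_def)
  then have \<Delta>: "\<Delta> = (\<Union>r<m. Pow (Fs ! r))"
    using Union_Pow_facets[OF assms(2)] by simp
  have "Psi_semi \<Delta> n = (\<Sum>H\<in>\<Delta>. face_term n (card H))"
    by (rule Psi_semi_f_vector[OF assms(2) n])
  also have "\<dots> = (\<Sum>r<m. \<Sum>H\<in>Pow (Fs ! r) - (\<Union>j<r. Pow (Fs ! j)). face_term n (card H))"
    by (subst \<Delta>, rule sum_UN_lessThan) (simp add: fin)
  also have "\<dots> = (\<Sum>r<m. case_prod (Phi_check n) (shelling_type Fs r))"
  proof (rule sum.cong)
    fix r assume r: "r \<in> {..<m}"
    obtain k i where ki: "shelling_type Fs r = (k, i)"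
      by fastforce
    show "(\<Sum>H\<in>Pow (Fs ! r) - (\<Union>j<r. Pow (Fs ! j)). face_term n (card H)) =
        case_prod (Phi_check n) (shelling_type Fs r)"
      using shelling_step[OF assms(2,4) _ ki] r n by (simp add: ki m_def Phi_check_eq)
  qed simp
  \<comment> \<open>On each group the summand is constant, and the size of the group is the entry of
    the h-triangle.\<close>
  also have "\<dots> = (\<Sum>t\<in>I. \<Sum>r\<in>{r\<in>{..<m}. shelling_type Fs r = t}.
      case_prod (Phi_check n) (shelling_type Fs r))"
    using type by (intro sum.group[symmetric]) (simp_all add: I_def image_subset_iff)
  also have "\<dots> = (\<Sum>(k, i)\<in>I. of_nat (h_triangle Fs k i) * Phi_check n k i)"
    by (intro sum.cong) (auto simp: h_triangle_def m_def)
  also have "\<dots> = (\<Sum>k=0..n. \<Sum>i=0..k. of_nat (h_triangle Fs k i) * Phi_check n k i)"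
    unfolding I_def by (intro sum.Sigma[symmetric]) auto
  finally show ?thesis .
qed

end
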